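(* Let $(X_k)_{k\geq 0}$ be a stationary ergodic process with values in a separable metric space $S$ and with marginal distribution $F$, and let $h\colon S\times S\to\mathbb{R}$ be a symmetric kernel (i.e. a measurable function with $h(x,y)=h(y,x)$ for all $x,y\in S$) that is bounded and $F\times F$-almost everywhere continuous. Then, as $n\to\infty$, $$\frac{1}{\binom{n}{2}}\sum_{1\leq i<j\leq n}h(X_i,X_j)\longrightarrow \iint h(x,y)\,dF(x)\,dF(y)$$ almost surely.
   Context: $S$ is equipped with its Borel $\sigma$-algebra, and $F$ is the law of $X_0$, a Borel probability measure on $S$. "$F\times F$-almost everywhere continuous" means that the set of points $(x,y)\in S\times S$ at which $h$ is not continuous has measure zero for the product measure $F\times F$. "Stationary ergodic" means that the process is strictly stationary and that the shift is ergodic for its law. *)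

theory Defs
  imports "HOL-Probability.Probability"
begin

definition path_law :: "'w measure \<Rightarrow> (nat \<Rightarrow> 'w \<Rightarrow> 'a :: topological_space) \<Rightarrow> (nat \<Rightarrow> 'a) measure"
  where "path_law M X = distr M (Pi\<^sub>M UNIV (\<lambda>_. borel)) (\<lambda>\<omega> k. X k \<omega>)"

definition strictly_stationary :: "'w measure \<Rightarrow> (nat \<Rightarrow> 'w \<Rightarrow> 'a :: topological_space) \<Rightarrow> bool"
  where "strictly_stationary M X \<longleftrightarrow> (\<forall>m. path_law M (\<lambda>k. X (k + m)) = path_law M X)"

definition seq_shift :: "(nat \<Rightarrow> 'a) \<Rightarrow> nat \<Rightarrow> 'a"
  where "seq_shift x = (\<lambda>k. x (Suc k))"

(* Only the triviality of invariant sets; that T preserves P is not part of this predicate.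
   It is meant for a probability measure P. *)
definition ergodic_for :: "'b measure \<Rightarrow> ('b \<Rightarrow> 'b) \<Rightarrow> bool"
  where "ergodic_for P T \<longleftrightarrow>
    (\<forall>A \<in> sets P. T -` A \<inter> space P = A \<longrightarrow> measure P A = 0 \<or> measure P A = 1)"

definition stationary_ergodic :: "'w measure \<Rightarrow> (nat \<Rightarrow> 'w \<Rightarrow> 'a :: topological_space) \<Rightarrow> bool"
  where "stationary_ergodic M X \<longleftrightarrow>
    strictly_stationary M X \<and> ergodic_for (path_law M X) seq_shift"

end

theory Submission
  imports Defs "HOL-Real_Asymp.Real_Asymp"
begin

text \<open>
  By the pointwise ergodic theorem, the empirical frequency of every Borel set converges almost
  surely to its \<open>F\<close>-measure. Hence the averages of a kernel over all pairs of times converge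
  almost surely for indicators of rectangles and their linear combinations. For the kernel \<open>h\<close>, take a
  countable base of rectangles \<open>R\<^sub>k\<close> of \<open>S \<times> S\<close> and let \<open>g\<^sub>m\<close> be the maximum of a lower bound of \<open>h\<close>
  and those infima \<open>inf h(R\<^sub>k)\<close>, \<open>k < m\<close>, whose rectangle contains the point. Then \<open>g\<^sub>m \<le> h\<close> is a step
  function, and \<open>g\<^sub>m \<rightarrow> h\<close> at every continuity point of \<open>h\<close>, so the lower limit of the averages of \<open>h\<close> is at
  least \<open>lim \<integral> g\<^sub>m = \<integral> h\<close>. The same bound for \<open>-h\<close> gives convergence, and the diagonal terms are
  negligible because \<open>h\<close> is bounded.
\<close>

section \<open>The pointwise ergodic theorem\<close>

lemma birkhoff_sum_Suc:
  "(\<Sum>k<Suc n. f ((T ^^ k) x)) = f x + (\<Sum>k<n. f ((T ^^ k) (T x)))"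
  by (simp only: sum.lessThan_Suc_shift) (simp add: funpow_swap1)

text \<open>This is the maximum of the Birkhoff sums of lengths \<open>0\<close> to
  \<open>n\<close>. The recursive form makes the increment \<open>M\<^sub>n\<^sub>+\<^sub>1 -
  M\<^sub>n \<circ> T = max (- M\<^sub>n \<circ> T) f\<close> immediate and reduces the bounds to
  inductions that generalise the starting point.\<close>

primrec max_birkhoff_sum :: "('b \<Rightarrow> 'b) \<Rightarrow> ('b \<Rightarrow> real) \<Rightarrow> nat \<Rightarrow> 'b \<Rightarrow> real" where
  "max_birkhoff_sum T f 0 x = 0"
| "max_birkhoff_sum T f (Suc n) x = max 0 (f x + max_birkhoff_sum T f n (T x))"

lemma max_birkhoff_sum_nonneg: "0 \<le> max_birkhoff_sum T f n x"
  by (cases n) auto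

lemma max_birkhoff_sum_mono: "max_birkhoff_sum T f n x \<le> max_birkhoff_sum T f (Suc n) x"
proof (induction n arbitrary: x)
  case (Suc n)
  then show ?case
    unfolding max_birkhoff_sum.simps(2)[of T f _ x]
    using Suc.IH[of "T x"] by (intro max.mono add_left_mono order_refl)
qed simp

lemma birkhoff_sum_le_max: "(\<Sum>k<n. f ((T ^^ k) x)) \<le> max_birkhoff_sum T f n x"
proof (induction n arbitrary: x)
  case (Suc n)
  then show ?case
    using Suc.IH[of "T x"] unfolding birkhoff_sum_Suc max_birkhoff_sum.simps by linarith
qed simp

lemma funpow_measurable [measurable (raw)]:
  assumes "T \<in> P \<rightarrow>\<^sub>M P"
  shows "T ^^ k \<in> P \<rightarrow>\<^sub>M P"
  using assms by (induction k) (auto simp: measurable_ident comp_def intro: measurable_compose)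

lemma integrable_max_birkhoff_sum:
  assumes T: "T \<in> P \<rightarrow>\<^sub>M P" and inv: "distr P P T = P" and f: "integrable P f"
  shows "integrable P (max_birkhoff_sum T f n)"
    and "integrable P (\<lambda>x. max_birkhoff_sum T f n (T x))"
    and "(\<integral>x. max_birkhoff_sum T f n (T x) \<partial>P) = (\<integral>x. max_birkhoff_sum T f n x \<partial>P)"
proof -
  have comp: "integrable P (\<lambda>x. g (T x))" if "integrable P g" for g :: "_ \<Rightarrow> real"
    using integrable_distr[OF T, of g] that inv by simp
  show int: "integrable P (max_birkhoff_sum T f n)"
  proof (induction n)
    case (Suc n)
    have "integrable P (\<lambda>x. max 0 (f x + max_birkhoff_sum T f n (T x)))"
      using f comp[OF Suc.IH] by (intro Bochner_Integration.integrable_max Bochner_Integration.integrable_add) auto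
    then show ?case by (simp cong: integrable_cong)
  qed (simp cong: integrable_cong)
  show "integrable P (\<lambda>x. max_birkhoff_sum T f n (T x))"
    by (rule comp[OF int])
  show "(\<integral>x. max_birkhoff_sum T f n (T x) \<partial>P) = (\<integral>x. max_birkhoff_sum T f n x \<partial>P)"
    using integral_distr[OF T, of "max_birkhoff_sum T f n"] int inv by simp
qed

text \<open>
  Write \<open>S\<^sub>n\<close> for the Birkhoff sums and \<open>M\<^sub>n\<close> for their maxima. The set where \<open>S\<^sub>n\<close> is unbounded is
  invariant. If it had full measure, then \<open>M\<^sub>n\<^sub>+\<^sub>1 - M\<^sub>n \<circ> T = max (- M\<^sub>n \<circ> T) f\<close> would converge to \<open>f\<close>
  almost everywhere; these functions are dominated by \<open>\<bar>f\<bar>\<close> and have nonnegative integrals, so \<open>f\<close>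
  would too.
\<close>

lemma birkhoff_sums_bdd_above:
  fixes f :: "'b \<Rightarrow> real"
  assumes "prob_space P" and T [measurable]: "T \<in> P \<rightarrow>\<^sub>M P" and inv: "distr P P T = P"
    and erg: "ergodic_for P T" and f: "integrable P f" and neg: "(\<integral>x. f x \<partial>P) < 0"
  shows "AE x in P. \<exists>B. \<forall>n. (\<Sum>k<n. f ((T ^^ k) x)) \<le> B"
proof -
  interpret prob_space P by fact
  have fm [measurable]: "f \<in> borel_measurable P" using f by simp
  define S where "S n x = (\<Sum>k<n. f ((T ^^ k) x))" for n x
  have Sm [measurable]: "S n \<in> borel_measurable P" for n
    unfolding S_def by (intro borel_measurable_sum) (rule measurable_compose[OF funpow_measurable[OF T] fm])
  \<comment> \<open>Natural levels make \<open>E\<close> a countable condition, hence measurable;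
    \<open>unb\<close> recovers arbitrary real levels.\<close>
  define E where "E = {x \<in> space P. \<forall>b::nat. \<exists>n. real b < S n x}"
  have E: "E \<in> sets P" unfolding E_def by measurable
  have S_Suc: "S (Suc n) x = f x + S n (T x)" for n x
    unfolding S_def by (rule birkhoff_sum_Suc)
  have unb: "\<exists>n. B < S n x" if "\<forall>b::nat. \<exists>n. real b < S n x" for B x
    using that reals_Archimedean2[of B] by (meson less_trans)
  have inE: "T x \<in> E \<longleftrightarrow> x \<in> E" if x: "x \<in> space P" for x
  proof
    assume TE: "T x \<in> E"
    have "\<exists>n. real b < S n x" for b
    proof -
      obtain n where "real b - f x < S n (T x)" using TE unb unfolding E_def by blast
      then have "real b < S (Suc n) x" by (simp add: S_Suc)
      then show ?thesis ..
    qed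
    with x show "x \<in> E" by (simp add: E_def)
  next
    assume xE: "x \<in> E"
    have "\<exists>n. real b < S n (T x)" for b
    proof -
      \<comment> \<open>The \<open>max 0\<close> excludes the empty sum \<open>S 0 x = 0\<close>, so
        the length is a successor and the first term can be split off.\<close>
      obtain n where n: "max 0 (real b + f x) < S n x" using xE unb unfolding E_def by blast
      then have "n \<noteq> 0" by (intro notI) (simp add: S_def)
      then obtain m where "n = Suc m" by (cases n) auto
      with n have "real b < S m (T x)" by (simp add: S_Suc)
      then show ?thesis ..
    qed
    with x measurable_space[OF T x] show "T x \<in> E" by (simp add: E_def)
  qed
  have "T -` E \<inter> space P = E"
    using inE by (auto simp: E_def)
  then have "prob E = 0 \<or> prob E = 1"
    using erg E by (auto simp: ergodic_for_def)
  moreover have "prob E \<noteq> 1"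
  proof
    assume "prob E = 1"
    then have aeE: "AE x in P. x \<in> E" using E by (simp add: AE_in_set_eq_1)
    define u where "u n x = max_birkhoff_sum T f (Suc n) x - max_birkhoff_sum T f n (T x)" for n x
    note int = integrable_max_birkhoff_sum[OF T inv f]
    have um: "u n \<in> borel_measurable P" for n
      unfolding u_def using int(1)[of "Suc n"] int(2)[of n] by (intro borel_measurable_diff) auto
    have bound: "\<bar>u n x\<bar> \<le> \<bar>f x\<bar>" for n x
      using max_birkhoff_sum_nonneg[of T f n "T x"] by (simp add: u_def)
    have lim: "(\<lambda>n. u n x) \<longlonglongrightarrow> f x" if "x \<in> E" for x
    \<comment> \<open>The sequence is eventually constant: once the maximum at \<open>T x\<close>
      exceeds \<open>- f x\<close>, the maximum with \<open>0\<close> in the recursion is no longer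
      attained by \<open>0\<close>.\<close>
    proof (rule tendsto_eventually)
      have x: "x \<in> space P" using that by (simp add: E_def)
      then have "T x \<in> E" using inE that by simp
      then obtain m where m: "- f x < S m (T x)" using unb unfolding E_def by blast
      have "u n x = f x" if "m \<le> n" for n
      proof -
        have "S m (T x) \<le> max_birkhoff_sum T f m (T x)"
          unfolding S_def by (rule birkhoff_sum_le_max)
        also have "\<dots> \<le> max_birkhoff_sum T f n (T x)"
          using that by (rule lift_Suc_mono_le[of "\<lambda>n. max_birkhoff_sum T f n (T x)", OF max_birkhoff_sum_mono])
        finally show ?thesis using m by (simp add: u_def)
      qed
      then show "\<forall>\<^sub>F n in sequentially. u n x = f x"
        by (auto simp: eventually_sequentially)
    qed
    have "(\<lambda>n. \<integral>x. u n x \<partial>P) \<longlonglongrightarrow> (\<integral>x. f x \<partial>P)"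
    proof (rule integral_dominated_convergence[where w = "\<lambda>x. \<bar>f x\<bar>"])
      show "AE x in P. (\<lambda>n. u n x) \<longlonglongrightarrow> f x" using aeE by eventually_elim (rule lim)
    qed (use um bound f in auto)
    \<comment> \<open>Invariance of \<open>P\<close> replaces the integral of
      \<open>M\<^sub>n \<circ> T\<close> by that of \<open>M\<^sub>n\<close>, and the maxima
      increase with \<open>n\<close>.\<close>
    moreover have "0 \<le> (\<integral>x. u n x \<partial>P)" for n
    proof -
      have "(\<integral>x. u n x \<partial>P) =
          (\<integral>x. max_birkhoff_sum T f (Suc n) x \<partial>P) - (\<integral>x. max_birkhoff_sum T f n x \<partial>P)"
        unfolding u_def int(3)[of n, symmetric]
        by (rule Bochner_Integration.integral_diff[OF int(1) int(2)])
      also have "\<dots> \<ge> 0"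
        using integral_mono[OF int(1)[of n] int(1)[of "Suc n"] max_birkhoff_sum_mono] by simp
      finally show ?thesis .
    qed
    ultimately have "0 \<le> (\<integral>x. f x \<partial>P)" by (intro LIMSEQ_le_const) auto
    with neg show False by simp
  qed
  ultimately have "AE x in P. x \<notin> E" 
    using E by (simp add: prob_eq_0)
  with AE_space show ?thesis
  proof eventually_elim
    case (elim x)
    then obtain b :: nat where "\<And>n. S n x \<le> real b" by (auto simp: E_def not_less)
    then show ?case by (auto simp: S_def)
  qed
qed

text \<open>Subtracting a constant slightly above the integral makes the integral negative, so the
  centred Birkhoff sums are bounded above; division by \<open>n\<close> removes the bound.\<close>

lemma birkhoff_upper:
  fixes f :: "'b \<Rightarrow> real"
  assumes "prob_space P" and T: "T \<in> P \<rightarrow>\<^sub>M P" and inv: "distr P P T = P"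
    and erg: "ergodic_for P T" and f: "integrable P f"
  shows "AE x in P. \<forall>a > (\<integral>x. f x \<partial>P). \<forall>\<^sub>F n in sequentially. (\<Sum>k<n. f ((T ^^ k) x)) / real n < a"
proof -
  interpret prob_space P by fact
  define I where "I = (\<integral>x. f x \<partial>P)"
  \<comment> \<open>Countably many margins \<open>1 / Suc j\<close> suffice for all
    \<open>a\<close>, so a single null set can be discarded.\<close>
  have "AE x in P. \<forall>j::nat. \<exists>B. \<forall>n. (\<Sum>k<n. f ((T ^^ k) x) - (I + 1 / Suc j)) \<le> B"
    unfolding AE_all_countable
  proof
    fix j :: nat
    have "(\<integral>x. f x - (I + 1 / Suc j) \<partial>P) = I - (I + 1 / Suc j)"
      using f by (subst Bochner_Integration.integral_diff) (auto simp: prob_space I_def)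
    then have "(\<integral>x. f x - (I + 1 / Suc j) \<partial>P) < 0" by simp
    then show "AE x in P. \<exists>B. \<forall>n. (\<Sum>k<n. f ((T ^^ k) x) - (I + 1 / Suc j)) \<le> B"
      using f by (intro birkhoff_sums_bdd_above[OF _ T inv erg]) (auto intro: prob_space_axioms)
  qed
  then show ?thesis
  proof eventually_elim
    case (elim x)
    show ?case
    proof (intro allI impI)
      fix a assume "(\<integral>x. f x \<partial>P) < a"
      then have "0 < a - I" by (simp add: I_def)
      then obtain j where j: "1 / Suc j < a - I"
        using nat_approx_posE by blast
      obtain B where B: "\<And>n. (\<Sum>k<n. f ((T ^^ k) x) - (I + 1 / Suc j)) \<le> B"
        using elim by meson
      have "(\<lambda>n. B / real n + (I + 1 / Suc j)) \<longlonglongrightarrow> 0 + (I + 1 / Suc j)"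
        by (intro tendsto_intros lim_const_over_n)
      moreover have "0 + (I + 1 / Suc j) < a" using j by simp
      ultimately have "\<forall>\<^sub>F n in sequentially. B / real n + (I + 1 / Suc j) < a"
        by (rule order_tendstoD)
      then show "\<forall>\<^sub>F n in sequentially. (\<Sum>k<n. f ((T ^^ k) x)) / real n < a"
        using eventually_gt_at_top[of 0]
      proof eventually_elim
        case (elim n)
        have "(\<Sum>k<n. f ((T ^^ k) x)) \<le> B + n * (I + 1 / Suc j)"
          using B[of n] by (simp add: sum_subtractf)
        then have "(\<Sum>k<n. f ((T ^^ k) x)) / n \<le> (B + n * (I + 1 / Suc j)) / n"
          by (rule divide_right_mono) simp
        also have "\<dots> = B / n + (I + 1 / Suc j)"
          using elim by (simp add: add_divide_distrib)
        finally show ?case using elim by linarith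
      qed
    qed
  qed
qed

lemma birkhoff_ergodic:
  fixes f :: "'b \<Rightarrow> real"
  assumes "prob_space P" and T: "T \<in> P \<rightarrow>\<^sub>M P" and inv: "distr P P T = P"
    and erg: "ergodic_for P T" and f: "integrable P f"
  shows "AE x in P. (\<lambda>n. (\<Sum>k<n. f ((T ^^ k) x)) / real n) \<longlonglongrightarrow> (\<integral>x. f x \<partial>P)"
proof -
  have "integrable P (\<lambda>x. - f x)" using f by simp
  from birkhoff_upper[OF assms] birkhoff_upper[OF assms(1-4) this]
  show ?thesis
  proof eventually_elim
    case (elim x)
    show ?case
    proof (rule order_tendstoI)
      fix a assume "a < (\<integral>x. f x \<partial>P)"
      then show "\<forall>\<^sub>F n in sequentially. a < (\<Sum>k<n. f ((T ^^ k) x)) / real n"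
        using elim(2)[rule_format, of "- a"] by (simp add: sum_negf)
    qed (use elim(1) in blast)
  qed
qed

section \<open>Averages of kernels over pairs of times\<close>

text \<open>The mean runs over the full square of times, diagonal included, so that for a rectangle
  it factors into two empirical frequencies.\<close>

definition pair_mean :: "(nat \<Rightarrow> 'a) \<Rightarrow> nat \<Rightarrow> ('a \<times> 'a \<Rightarrow> real) \<Rightarrow> real" where
  "pair_mean x n g = (\<Sum>i<n. \<Sum>j<n. g (x i, x j)) / (real n)\<^sup>2"

lemma pair_mean_add: "pair_mean x n (\<lambda>z. f z + g z) = pair_mean x n f + pair_mean x n g"
  by (simp add: pair_mean_def sum.distrib add_divide_distrib)

lemma pair_mean_diff: "pair_mean x n (\<lambda>z. f z - g z) = pair_mean x n f - pair_mean x n g"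
  by (simp add: pair_mean_def sum_subtractf diff_divide_distrib)

lemma pair_mean_uminus: "pair_mean x n (\<lambda>z. - f z) = - pair_mean x n f"
  by (simp add: pair_mean_def sum_negf)

lemma pair_mean_mono: "(\<And>z. f z \<le> g z) \<Longrightarrow> pair_mean x n f \<le> pair_mean x n g"
  unfolding pair_mean_def by (intro divide_right_mono sum_mono) auto

lemma pair_mean_rectangle:
  "pair_mean x n (\<lambda>z. indicator (A \<times> B) z * c) =
    ((\<Sum>i<n. indicator A (x i)) / real n) * ((\<Sum>i<n. indicator B (x i)) / real n) * c"
proof -
  have "(\<Sum>i<n. \<Sum>j<n. indicator (A \<times> B) (x i, x j) * c) =
      (\<Sum>i<n. indicator A (x i)) * (\<Sum>j<n. indicator B (x j)) * c"
    unfolding indicator_times fst_conv snd_conv sum_product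
    by (simp only: sum_distrib_right)
  then show ?thesis by (simp add: pair_mean_def power2_eq_square)
qed

section \<open>Step functions over finitely many rectangles\<close>

primrec step_max ::
  "real \<Rightarrow> (nat \<Rightarrow> 'a set) \<Rightarrow> (nat \<Rightarrow> 'a set) \<Rightarrow> (nat \<Rightarrow> real) \<Rightarrow> nat \<Rightarrow> 'a \<times> 'a \<Rightarrow> real"
  where
    "step_max b U V c 0 z = b"
  | "step_max b U V c (Suc m) z =
      (if z \<in> U m \<times> V m then max (step_max b U V c m z) (c m) else step_max b U V c m z)"

lemma step_max_ge_base: "b \<le> step_max b U V c m z"
  by (induction m) auto

lemma step_max_ge: "k < m \<Longrightarrow> z \<in> U k \<times> V k \<Longrightarrow> c k \<le> step_max b U V c m z"
  by (induction m) (auto simp: less_Suc_eq)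

lemma step_max_le:
  assumes "b \<le> y" and "\<And>k. z \<in> U k \<times> V k \<Longrightarrow> c k \<le> y"
  shows "step_max b U V c m z \<le> y"
  using assms by (induction m) auto

text \<open>The only link between the process and \<open>F\<close> is the convergence of
  frequencies, with a null set that may depend on \<open>A\<close>; the kernel argument does not
  refer to stationarity or ergodicity.\<close>

locale averaging_process = prob_space F
  for F :: "'a :: t2_space measure" +
  fixes M :: "'w measure" and Y :: "nat \<Rightarrow> 'w \<Rightarrow> 'a"
  assumes sets_F [measurable_cong]: "sets F = sets borel"
    and averages: "A \<in> sets F \<Longrightarrow>
      AE \<omega> in M. (\<lambda>n. (\<Sum>i<n. indicator A (Y i \<omega>)) / real n) \<longlonglongrightarrow> prob A"
begin

sublocale FF: pair_prob_space F F ..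

text \<open>Integrability is included because closure under sums and differences relies on
  additivity of the Bochner integral.\<close>

definition averages_kernel :: "('a \<times> 'a \<Rightarrow> real) \<Rightarrow> bool" where
  "averages_kernel g \<longleftrightarrow> integrable (F \<Otimes>\<^sub>M F) g \<and>
    (AE \<omega> in M. (\<lambda>n. pair_mean (\<lambda>i. Y i \<omega>) n g) \<longlonglongrightarrow> (\<integral>z. g z \<partial>(F \<Otimes>\<^sub>M F)))"

lemma averages_kernel_add:
  assumes "averages_kernel f" "averages_kernel g"
  shows "averages_kernel (\<lambda>z. f z + g z)"
proof -
  have "AE \<omega> in M. (\<lambda>n. pair_mean (\<lambda>i. Y i \<omega>) n f + pair_mean (\<lambda>i. Y i \<omega>) n g)
      \<longlonglongrightarrow> (\<integral>z. f z \<partial>(F \<Otimes>\<^sub>M F)) + (\<integral>z. g z \<partial>(F \<Otimes>\<^sub>M F))"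
    using assms unfolding averages_kernel_def by (auto elim!: eventually_elim2 intro: tendsto_add)
  with assms show ?thesis by (simp add: averages_kernel_def pair_mean_add)
qed

lemma averages_kernel_diff:
  assumes "averages_kernel f" "averages_kernel g"
  shows "averages_kernel (\<lambda>z. f z - g z)"
proof -
  have "AE \<omega> in M. (\<lambda>n. pair_mean (\<lambda>i. Y i \<omega>) n f - pair_mean (\<lambda>i. Y i \<omega>) n g)
      \<longlonglongrightarrow> (\<integral>z. f z \<partial>(F \<Otimes>\<^sub>M F)) - (\<integral>z. g z \<partial>(F \<Otimes>\<^sub>M F))"
    using assms unfolding averages_kernel_def by (auto elim!: eventually_elim2 intro: tendsto_diff)
  with assms show ?thesis by (simp add: averages_kernel_def pair_mean_diff)
qed

lemma averages_kernel_rectangle: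
  assumes [measurable]: "A \<in> sets F" "B \<in> sets F"
  shows "averages_kernel (\<lambda>z. indicator (A \<times> B) z * c)"
proof -
  have "measure (F \<Otimes>\<^sub>M F) (A \<times> B) = prob A * prob B"
    using assms by (simp add: measure_def emeasure_pair_measure_Times enn2real_mult)
  moreover have "A \<times> B \<in> sets (F \<Otimes>\<^sub>M F)" by measurable
  ultimately have "(\<integral>z. indicator (A \<times> B) z * c \<partial>(F \<Otimes>\<^sub>M F)) = prob A * prob B * c"
    and "integrable (F \<Otimes>\<^sub>M F) (\<lambda>z. indicator (A \<times> B) z * c)"
    by (auto intro!: integrable_mult_left integrable_real_indicator simp: less_top[symmetric])
  moreover have "AE \<omega> in M. (\<lambda>n. pair_mean (\<lambda>i. Y i \<omega>) n (\<lambda>z. indicator (A \<times> B) z * c))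
      \<longlonglongrightarrow> prob A * prob B * c"
    using averages[OF assms(1)] averages[OF assms(2)] unfolding pair_mean_rectangle
    by eventually_elim (intro tendsto_intros)
  ultimately show ?thesis by (simp only: averages_kernel_def)
qed

text \<open>
  The statement must quantify over \<open>\<phi>\<close>: on the next rectangle, passing from \<open>m\<close> to \<open>m + 1\<close> replaces \<open>\<phi>\<close>
  by \<open>\<lambda>t. \<phi> (max t (c m))\<close>, and off it nothing changes.
\<close>

lemma averages_kernel_step_max_aux:
  assumes UV: "\<And>k. U k \<in> sets F" "\<And>k. V k \<in> sets F" and AB: "A \<in> sets F" "B \<in> sets F"
  shows "averages_kernel (\<lambda>z. indicator (A \<times> B) z * \<phi> (step_max b U V c m z))"
  using AB
proof (induction m arbitrary: A B \<phi>)
  case 0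
  then show ?case by (simp add: averages_kernel_rectangle)
next
  case (Suc m)
  let ?s = "step_max b U V c m"
  \<comment> \<open>The intersection of two rectangles is again a rectangle, so the induction
    hypothesis covers both the piece removed and the piece put back.\<close>
  let ?R = "(A \<inter> U m) \<times> (B \<inter> V m)"
  have "averages_kernel (\<lambda>z. indicator (A \<times> B) z * \<phi> (?s z) - indicator ?R z * \<phi> (?s z)
      + indicator ?R z * \<phi> (max (?s z) (c m)))"
    using Suc.prems UV
    by (intro averages_kernel_add averages_kernel_diff Suc.IH[of _ _ \<phi>]
        Suc.IH[of _ _ "\<lambda>t. \<phi> (max t (c m))"]) auto
  also have "(\<lambda>z. indicator (A \<times> B) z * \<phi> (?s z) - indicator ?R z * \<phi> (?s z)
      + indicator ?R z * \<phi> (max (?s z) (c m)))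
    = (\<lambda>z. indicator (A \<times> B) z * \<phi> (step_max b U V c (Suc m) z))"
    by (auto simp: fun_eq_iff indicator_def)
  finally show ?case .
qed

lemma averages_kernel_step_max:
  assumes "\<And>k. U k \<in> sets F" "\<And>k. V k \<in> sets F"
  shows "averages_kernel (step_max b U V c m)"
  using averages_kernel_step_max_aux[OF assms, of UNIV UNIV "\<lambda>t. t"] by (simp add: sets_F)

text \<open>Approximation from below by step functions suffices for a lower bound, and it needs
  convergence of the step functions only at continuity points of \<open>h\<close>.\<close>

lemma pair_mean_eventually_gt:
  fixes W :: "nat \<Rightarrow> 'a set" and h :: "'a \<times> 'a \<Rightarrow> real"
  assumes W: "topological_basis (range W)"
    and hm: "h \<in> borel_measurable (F \<Otimes>\<^sub>M F)"
    and bound: "\<And>z. \<bar>h z\<bar> \<le> C"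
    and cont: "AE z in F \<Otimes>\<^sub>M F. isCont h z"
  shows "AE \<omega> in M. \<forall>a < (\<integral>z. h z \<partial>(F \<Otimes>\<^sub>M F)).
    \<forall>\<^sub>F n in sequentially. a < pair_mean (\<lambda>i. Y i \<omega>) n h"
proof -
  define U where "U k = W (fst (prod_decode k))" for k
  define V where "V k = W (snd (prod_decode k))" for k
  \<comment> \<open>On an empty rectangle this infimum is an unspecified real, which is harmless
    because \<open>step_max\<close> uses \<open>c k\<close> only at points of the rectangle.\<close>
  define c where "c k = Inf (h ` (U k \<times> V k))" for k
  define g where "g = step_max (- C) U V c"
  have UV: "U k \<in> sets F" "V k \<in> sets F" for k
    using topological_basis_open[OF W] by (auto simp: U_def V_def sets_F)
  have good: "averages_kernel (g m)" for m
    unfolding g_def by (rule averages_kernel_step_max) (rule UV)+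
  have basis: "\<exists>i. x \<in> W i \<and> W i \<subseteq> G" if "open G" "x \<in> G" for G x
    using topological_basisE[OF W that] by blast
  have bdd: "bdd_below (h ` Z)" for Z
    using bound by (intro bdd_belowI[of _ "- C"]) (auto simp: abs_le_iff minus_le_iff)
  have lower: "- C \<le> h z" for z using bound[of z] by linarith
  have c_le: "c k \<le> h z" if "z \<in> U k \<times> V k" for k z
    unfolding c_def using that by (intro cInf_lower bdd) auto
  have g_le: "g m z \<le> h z" for m z
    unfolding g_def by (rule step_max_le[OF lower c_le])
  have g_ge: "- C \<le> g m z" for m z
    unfolding g_def by (rule step_max_ge_base)
  have lim: "(\<lambda>m. g m z) \<longlonglongrightarrow> h z" if "isCont h z" for z
  proof (rule order_tendstoI)
    fix a assume a: "a < h z"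
    then obtain a' where a': "a < a'" "a' < h z" using dense by blast
    have "\<forall>\<^sub>F w in nhds z. a' < h w"
      using that a'(2) by (metis continuous_within isCont_def order_tendstoD(1) tendsto_at_iff_tendsto_nhds)
    then obtain G where G: "open G" "z \<in> G" "\<And>w. w \<in> G \<Longrightarrow> a' < h w"
      unfolding eventually_nhds by blast
    obtain A B where AB: "open A" "open B" "z \<in> A \<times> B" "A \<times> B \<subseteq> G"
      using open_prod_elim[OF G(1,2)] by metis
    obtain i j where "fst z \<in> W i" "W i \<subseteq> A" "snd z \<in> W j" "W j \<subseteq> B"
      using basis[OF AB(1), of "fst z"] basis[OF AB(2), of "snd z"] AB(3) by (auto simp: mem_Times_iff)
    then obtain k where k: "z \<in> U k \<times> V k" "U k \<times> V k \<subseteq> A \<times> B"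
      by (intro that[of "prod_encode (i, j)"]) (auto simp: U_def V_def mem_Times_iff)
    have "a' < h w" if "w \<in> U k \<times> V k" for w
      using that k(2) AB(4) G(3) by blast
    then have "a' \<le> c k"
      unfolding c_def using k(1) by (intro cInf_greatest) (blast, force)
    then have "a < g m z" if "k < m" for m
      using a'(1) step_max_ge[of k m z U V c "- C"] that k(1) by (simp add: g_def)
    then show "\<forall>\<^sub>F m in sequentially. a < g m z"
      by (rule eventually_mono[OF eventually_gt_at_top[of k]])
  next
    fix a assume "h z < a"
    then have "g m z < a" for m by (rule le_less_trans[OF g_le])
    then show "\<forall>\<^sub>F m in sequentially. g m z < a" by simp
  qed
  have int_lim: "(\<lambda>m. \<integral>z. g m z \<partial>(F \<Otimes>\<^sub>M F)) \<longlonglongrightarrow> (\<integral>z. h z \<partial>(F \<Otimes>\<^sub>M F))"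
  proof (rule integral_dominated_convergence[where w = "\<lambda>_. C"])
    show "AE z in F \<Otimes>\<^sub>M F. (\<lambda>m. g m z) \<longlonglongrightarrow> h z"
      using cont by eventually_elim (rule lim)
    show "g m \<in> borel_measurable (F \<Otimes>\<^sub>M F)" for m
      using good[of m] by (auto simp: averages_kernel_def)
    show "AE z in F \<Otimes>\<^sub>M F. norm (g m z) \<le> C" for m
    proof (rule AE_I2)
      fix z show "norm (g m z) \<le> C" using g_le[of m z] g_ge[of m z] bound[of z] by auto
    qed
  qed (use hm in auto)
  \<comment> \<open>The approximants form a countable family fixed in advance, so one null set
    serves every \<open>m\<close> and hence every \<open>a\<close>.\<close>
  have "AE \<omega> in M. \<forall>m. (\<lambda>n. pair_mean (\<lambda>i. Y i \<omega>) n (g m)) \<longlonglongrightarrow> (\<integral>z. g m z \<partial>(F \<Otimes>\<^sub>M F))"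
    using good by (auto simp: AE_all_countable averages_kernel_def)
  then show ?thesis
  proof eventually_elim
    case (elim \<omega>)
    show ?case
    proof (intro allI impI)
      fix a assume "a < (\<integral>z. h z \<partial>(F \<Otimes>\<^sub>M F))"
      then obtain m where "a < (\<integral>z. g m z \<partial>(F \<Otimes>\<^sub>M F))"
        using order_tendstoD(1)[OF int_lim] eventually_happens' trivial_limit_sequentially by blast
      with elim have "\<forall>\<^sub>F n in sequentially. a < pair_mean (\<lambda>i. Y i \<omega>) n (g m)"
        using order_tendstoD(1) by blast
      then show "\<forall>\<^sub>F n in sequentially. a < pair_mean (\<lambda>i. Y i \<omega>) n h"
        by (rule eventually_mono) (erule less_le_trans, rule pair_mean_mono, rule g_le)
    qed
  qed
qed

lemma pair_mean_tendsto:
  fixes W :: "nat \<Rightarrow> 'a set" and h :: "'a \<times> 'a \<Rightarrow> real"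
  assumes W: "topological_basis (range W)"
    and hm: "h \<in> borel_measurable (F \<Otimes>\<^sub>M F)"
    and bound: "\<And>z. \<bar>h z\<bar> \<le> C"
    and cont: "AE z in F \<Otimes>\<^sub>M F. isCont h z"
  shows "AE \<omega> in M. (\<lambda>n. pair_mean (\<lambda>i. Y i \<omega>) n h) \<longlonglongrightarrow> (\<integral>z. h z \<partial>(F \<Otimes>\<^sub>M F))"
proof -
  have "AE z in F \<Otimes>\<^sub>M F. isCont (\<lambda>z. - h z) z"
    using cont by eventually_elim (rule continuous_minus)
  then have "AE \<omega> in M. \<forall>a < (\<integral>z. - h z \<partial>(F \<Otimes>\<^sub>M F)).
      \<forall>\<^sub>F n in sequentially. a < pair_mean (\<lambda>i. Y i \<omega>) n (\<lambda>z. - h z)"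
    using hm bound by (intro pair_mean_eventually_gt[OF W]) auto
  with pair_mean_eventually_gt[OF assms] show ?thesis
  proof eventually_elim
    case (elim \<omega>)
    show ?case
    proof (rule order_tendstoI)
      fix a assume "(\<integral>z. h z \<partial>(F \<Otimes>\<^sub>M F)) < a"
      then show "\<forall>\<^sub>F n in sequentially. pair_mean (\<lambda>i. Y i \<omega>) n h < a"
        using elim(2)[rule_format, of "- a"] by (simp add: pair_mean_uminus)
    qed (use elim(1) in blast)
  qed
qed

end

section \<open>Countable bases of separable metric spaces\<close>

lemma separable_metric_countable_base:
  assumes "separable_space (euclidean :: 'a :: metric_space topology)"
  obtains W :: "nat \<Rightarrow> 'a :: metric_space set" where "topological_basis (range W)"
proof -
  obtain D :: "'a set" where D: "countable D" "closure D = UNIV"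
    using assms by (auto simp: separable_space_def)
  then have ne: "D \<noteq> {}" by auto
  define W where "W k = (case prod_decode k of (i, n) \<Rightarrow> ball (from_nat_into D i) (1 / Suc n))" for k
  show ?thesis
  proof (rule that, rule topological_basisI)
    show "open A" if "A \<in> range W" for A using that by (auto simp: W_def split: prod.split)
  next
    fix G :: "'a set" and x assume "open G" "x \<in> G"
    then obtain e where e: "0 < e" "ball x e \<subseteq> G" by (auto simp: open_contains_ball)
    \<comment> \<open>Half of \<open>e\<close> is enough: a ball of radius \<open>1 / Suc n\<close>
      whose centre is that close to \<open>x\<close> has all its points within
      \<open>2 / Suc n < e\<close> of \<open>x\<close>.\<close>
    then obtain n where n: "1 / Suc n < e / 2" using nat_approx_posE[of "e / 2"] by auto
    have "x \<in> closure D" using D by simp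
    then obtain d where d: "d \<in> D" "dist d x < 1 / Suc n"
      unfolding closure_approachable by (meson of_nat_0_less_iff zero_less_Suc zero_less_divide_1_iff)
    obtain i where i: "from_nat_into D i = d" using from_nat_into_surj[OF D(1) d(1)] ..
    have "y \<in> ball x e" if "y \<in> ball d (1 / Suc n)" for y
      using that d(2) n dist_triangle[of x y d] by (simp add: dist_commute)
    with e have "ball d (1 / Suc n) \<subseteq> G" by blast
    moreover have "W (prod_encode (i, n)) = ball d (1 / Suc n)" by (simp add: W_def i)
    ultimately have "x \<in> W (prod_encode (i, n)) \<and> W (prod_encode (i, n)) \<subseteq> G"
      using d(2) by simp
    then show "\<exists>A\<in>range W. x \<in> A \<and> A \<subseteq> G" by blast
  qed
qed

section \<open>U-statistics of ergodic processes\<close>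

text \<open>
  The averages are over the times \<open>1, \<dots>, n\<close>. By stationarity the path starting at time \<open>1\<close>
  also has law \<open>path_law M X\<close>, so the ergodic theorem applies to it directly.
\<close>

lemma indicator_averages:
  fixes X :: "nat \<Rightarrow> 'w \<Rightarrow> 'a :: topological_space"
  assumes M: "prob_space M" and X [measurable]: "\<And>k. X k \<in> M \<rightarrow>\<^sub>M borel"
    and se: "stationary_ergodic M X" and A [measurable]: "A \<in> sets borel"
  shows "AE \<omega> in M. (\<lambda>n. (\<Sum>i<n. indicator A (X (Suc i) \<omega>)) / real n)
    \<longlonglongrightarrow> measure (distr M borel (X 0)) A"
proof -
  interpret M: prob_space M by fact
  let ?N = "Pi\<^sub>M UNIV (\<lambda>_. borel) :: (nat \<Rightarrow> 'a) measure"
  define P where "P = path_law M X"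
  have path [measurable]: "(\<lambda>\<omega> k. X (k + m) \<omega>) \<in> M \<rightarrow>\<^sub>M ?N" for m
    by (rule measurable_PiM_single') auto
  have path0 [measurable]: "(\<lambda>\<omega> k. X k \<omega>) \<in> M \<rightarrow>\<^sub>M ?N"
    using path[of 0] by simp
  have sets_P [measurable_cong]: "sets P = sets ?N"
    by (simp add: P_def path_law_def)
  have P: "prob_space P"
    unfolding P_def path_law_def by (rule M.prob_space_distr) measurable
  then interpret P: prob_space P .
  have shiftN [measurable]: "seq_shift \<in> ?N \<rightarrow>\<^sub>M ?N"
    unfolding seq_shift_def by (rule measurable_PiM_single') auto
  have shift: "seq_shift \<in> P \<rightarrow>\<^sub>M P"
    by measurable
  have stat: "path_law M (\<lambda>k. X (k + 1)) = P"
    using se unfolding stationary_ergodic_def strictly_stationary_def P_def by blast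
  \<comment> \<open>Pushing the path law forward by the shift gives the law of the path from time
    \<open>1\<close>, so invariance is stationarity with \<open>m = 1\<close>.\<close>
  have "distr P P seq_shift = distr P ?N seq_shift"
    by (rule distr_cong) (auto simp: sets_P)
  also have "\<dots> = distr M ?N (\<lambda>\<omega> k. X (k + 1) \<omega>)"
    unfolding P_def path_law_def by (subst distr_distr) (auto simp: seq_shift_def comp_def)
  finally have inv: "distr P P seq_shift = P"
    using stat by (simp add: path_law_def)
  let ?f = "\<lambda>x :: nat \<Rightarrow> 'a. indicator A (x 0) :: real"
  have f [measurable]: "?f \<in> borel_measurable P" by measurable
  have int: "integrable P ?f"
    by (rule P.integrable_const_bound[where B = 1]) auto
  have val: "(\<integral>x. ?f x \<partial>P) = measure (distr M borel (X 0)) A"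
  proof -
    have "(\<integral>x. ?f x \<partial>P) = (\<integral>\<omega>. indicator A (X 0 \<omega>) \<partial>M)"
      unfolding P_def path_law_def by (subst integral_distr) auto
    also have "\<dots> = (\<integral>x. indicator A x \<partial>distr M borel (X 0))"
      by (subst integral_distr) auto
    finally show ?thesis by simp
  qed
  have iter: "(seq_shift ^^ k) x = (\<lambda>i. x (i + k))" for k and x :: "nat \<Rightarrow> 'a"
    by (induction k arbitrary: x) (auto simp: seq_shift_def)
  have "ergodic_for P seq_shift"
    using se by (simp add: stationary_ergodic_def P_def)
  from birkhoff_ergodic[OF P shift inv this int]
  have "AE x in path_law M (\<lambda>k. X (k + 1)).
      (\<lambda>n. (\<Sum>i<n. indicator A (x i)) / real n)
      \<longlonglongrightarrow> measure (distr M borel (X 0)) A"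
    unfolding stat val by (simp add: iter)
  then show ?thesis
    unfolding path_law_def by (subst (asm) AE_distr_iff) (use path[of 1] in simp_all)
qed

section \<open>From means over the square to U-statistics\<close>

lemma sum_symmetric_square:
  fixes f :: "nat \<Rightarrow> nat \<Rightarrow> real"
  assumes "\<And>i j. f i j = f j i"
  shows "2 * (\<Sum>(i, j) \<in> {(i, j). i < j \<and> j < n}. f i j) = (\<Sum>i<n. \<Sum>j<n. f i j) - (\<Sum>i<n. f i i)"
proof (induction n)
  case (Suc n)
  have fin: "finite {(i, j). i < j \<and> j < n}" for n :: nat
    by (rule finite_subset[of _ "{..<n} \<times> {..<n}"]) auto
  \<comment> \<open>The triangle gains the column of pairs \<open>(i, n)\<close>. The square gains
    this column, a row with the same sum by symmetry, and the corner, which cancels against the new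
    diagonal term.\<close>
  have "{(i, j). i < j \<and> j < Suc n} = {(i, j). i < j \<and> j < n} \<union> (\<lambda>i. (i, n)) ` {..<n}"
    by auto
  then have "(\<Sum>(i, j) \<in> {(i, j). i < j \<and> j < Suc n}. f i j) =
      (\<Sum>(i, j) \<in> {(i, j). i < j \<and> j < n}. f i j) + (\<Sum>(i, j) \<in> (\<lambda>i. (i, n)) ` {..<n}. f i j)"
    using fin by (simp only:) (rule sum.union_disjoint, auto)
  also have "(\<Sum>(i, j) \<in> (\<lambda>i. (i, n)) ` {..<n}. f i j) = (\<Sum>i<n. f i n)"
    by (subst sum.reindex) (auto simp: inj_on_def)
  finally have "2 * (\<Sum>(i, j) \<in> {(i, j). i < j \<and> j < Suc n}. f i j) =
      (\<Sum>i<n. \<Sum>j<n. f i j) - (\<Sum>i<n. f i i) + 2 * (\<Sum>i<n. f i n)"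
    using Suc.IH by simp
  moreover have "(\<Sum>j<n. f n j) = (\<Sum>i<n. f i n)"
    by (intro sum.cong refl assms)
  ultimately show ?case by (simp add: sum.distrib)
qed simp

lemma sum_pairs_Suc:
  "(\<Sum>(i, j) \<in> {(i, j). 1 \<le> i \<and> i < j \<and> j \<le> n}. f i j) =
    (\<Sum>(i, j) \<in> {(i, j). i < j \<and> j < n}. f (Suc i) (Suc j))"
  by (rule sum.reindex_bij_witness[where i = "\<lambda>(i, j). (Suc i, Suc j)" and j = "\<lambda>(i, j). (i - 1, j - 1)"])
    auto

text \<open>The U-statistic is the mean over the square times \<open>n / (n - 1)\<close>, minus the
  diagonal sum over \<open>n (n - 1)\<close>. The factor tends to \<open>1\<close>, and the diagonal
  sum is at most \<open>n C\<close> in absolute value.\<close>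

lemma u_statistic_tendsto:
  fixes h :: "'a \<Rightarrow> 'a \<Rightarrow> real"
  assumes sym: "\<And>x y. h x y = h y x" and bound: "\<And>x y. \<bar>h x y\<bar> \<le> C"
    and lim: "(\<lambda>n. pair_mean (\<lambda>i. x (Suc i)) n (\<lambda>(x, y). h x y)) \<longlonglongrightarrow> L"
  shows "(\<lambda>n. 1 / real (n choose 2) *
    (\<Sum>(i, j) \<in> {(i, j). 1 \<le> i \<and> i < j \<and> j \<le> n}. h (x i) (x j))) \<longlonglongrightarrow> L"
proof -
  let ?d = "\<lambda>n. \<Sum>i<n. h (x (Suc i)) (x (Suc i))"
  let ?p = "\<lambda>n. pair_mean (\<lambda>i. x (Suc i)) n (\<lambda>(x, y). h x y)"
  have "(\<lambda>n. ?d n / (real n * (real n - 1))) \<longlonglongrightarrow> 0"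
  proof (rule Lim_null_comparison)
    show "\<forall>\<^sub>F n in sequentially. norm (?d n / (real n * (real n - 1))) \<le> C * (1 / (real n - 1))"
      using eventually_gt_at_top[of 1]
    proof eventually_elim
      case (elim n)
      have "\<bar>?d n\<bar> \<le> (\<Sum>i<n. C)" using bound by (intro order_trans[OF sum_abs] sum_mono)
      then have "\<bar>?d n\<bar> / (real n * (real n - 1)) \<le> real n * C / (real n * (real n - 1))"
        using elim by (intro divide_right_mono) auto
      then show ?case using elim by (simp add: abs_mult)
    qed
    have "(\<lambda>n. 1 / (real n - 1)) \<longlonglongrightarrow> 0" by real_asymp
    from tendsto_mult_right_zero[OF this] show "(\<lambda>n. C * (1 / (real n - 1))) \<longlonglongrightarrow> 0" .
  qed
  moreover have "(\<lambda>n. real n / (real n - 1)) \<longlonglongrightarrow> 1" by real_asymp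
  ultimately have lim_u: "(\<lambda>n. ?p n * (real n / (real n - 1)) - ?d n / (real n * (real n - 1))) \<longlonglongrightarrow> L * 1 - 0"
    by (intro tendsto_intros lim)
  have alg: "q / N\<^sup>2 * (N / D) - d / (N * D) = 1 / (N * D / 2) * ((q - d) / 2)"
    if "N \<noteq> 0" "D \<noteq> 0" for N D q d :: real
    using that by (simp add: field_simps power2_eq_square)
  have "\<forall>\<^sub>F n in sequentially. ?p n * (real n / (real n - 1)) - ?d n / (real n * (real n - 1)) =
    1 / real (n choose 2) * (\<Sum>(i, j) \<in> {(i, j). 1 \<le> i \<and> i < j \<and> j \<le> n}. h (x i) (x j))"
    using eventually_gt_at_top[of 1]
  proof eventually_elim
    case (elim n)
    \<comment> \<open>The formula \<open>choose_two\<close> divides in the natural numbers, so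
      evenness of \<open>n * (n - 1)\<close> is settled before passing to reals.\<close>
    have "2 * (n choose 2) = n * (n - 1)"
      unfolding choose_two by (rule dvd_mult_div_cancel) (cases n, auto)
    then have "real (2 * (n choose 2)) = real (n * (n - 1))" by (rule arg_cong)
    then have ch: "real (n choose 2) = real n * (real n - 1) / 2"
      using elim by (simp add: of_nat_diff)
    define q where "q = (\<Sum>i<n. \<Sum>j<n. h (x (Suc i)) (x (Suc j)))"
    define s where "s = (\<Sum>(i, j) \<in> {(i, j). i < j \<and> j < n}. h (x (Suc i)) (x (Suc j)))"
    have "2 * s = q - ?d n"
      unfolding q_def s_def using sym by (rule sum_symmetric_square)
    then have s: "s = (q - ?d n) / 2" by simp
    have p: "?p n = q / (real n)\<^sup>2" by (simp add: pair_mean_def q_def)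
    show ?case
      unfolding sum_pairs_Suc s_def[symmetric] ch s p by (rule alg) (use elim in auto)
  qed
  from Lim_transform_eventually[OF lim_u this] show ?thesis by simp
qed

theorem theorem2p1:
  fixes M :: "'w measure"
    and X :: "nat \<Rightarrow> 'w \<Rightarrow> 'a :: metric_space"
    and F :: "'a measure"
    and h :: "'a \<Rightarrow> 'a \<Rightarrow> real"
  assumes "separable_space (euclidean :: 'a topology)"
    and "prob_space M"
    and "\<And>k. X k \<in> M \<rightarrow>\<^sub>M borel"
    and "stationary_ergodic M X"
    and "F = distr M borel (X 0)"
    and "(\<lambda>(x, y). h x y) \<in> borel_measurable (borel \<Otimes>\<^sub>M borel)"
    and "\<And>x y. h x y = h y x"
    and "bounded (range (\<lambda>(x, y). h x y))"
    and "AE z in F \<Otimes>\<^sub>M F. isCont (\<lambda>(x, y). h x y) z"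
  shows "AE \<omega> in M.
    (\<lambda>n. 1 / real (n choose 2) *
       (\<Sum>(i, j) \<in> {(i, j). 1 \<le> i \<and> i < j \<and> j \<le> n}. h (X i \<omega>) (X j \<omega>)))
      \<longlonglongrightarrow> (\<integral>y. (\<integral>x. h x y \<partial>F) \<partial>F)"
proof -
  let ?h = "\<lambda>(x, y). h x y"
  have sets_F [measurable_cong]: "sets F = sets borel" using assms(5) by simp
  interpret F: prob_space F
    unfolding assms(5) using assms(2,3) by (rule prob_space.prob_space_distr)
  interpret averaging_process F M "\<lambda>i. X (Suc i)"
  proof
    fix A assume "A \<in> sets F"
    then show "AE \<omega> in M. (\<lambda>n. (\<Sum>i<n. indicator A (X (Suc i) \<omega>)) / real n)
        \<longlonglongrightarrow> measure F A"
      unfolding assms(5) by (intro indicator_averages assms(2-4)) simp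
  qed (rule sets_F)
  obtain C where C: "\<And>z. \<bar>?h z\<bar> \<le> C"
    using assms(8) by (auto simp: bounded_iff)
  have hm [measurable]: "?h \<in> borel_measurable (F \<Otimes>\<^sub>M F)"
    using assms(6) by (simp cong: measurable_cong_sets add: sets_pair_measure_cong[OF sets_F sets_F])
  have int: "integrable (F \<Otimes>\<^sub>M F) ?h"
    by (rule FF.P.integrable_const_bound[where B = C]) (use C in auto)
  \<comment> \<open>Fubini gives the iterated integral with the second variable integrated first;
    symmetry of \<open>h\<close> turns it into the stated order.\<close>
  have eq: "(\<integral>z. ?h z \<partial>(F \<Otimes>\<^sub>M F)) = (\<integral>y. (\<integral>x. h x y \<partial>F) \<partial>F)"
    using FF.integral_fst'[OF int] by (simp add: assms(7))
  obtain W :: "nat \<Rightarrow> 'a set" where W: "topological_basis (range W)"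
    using separable_metric_countable_base[OF assms(1)] .
  from pair_mean_tendsto[OF W hm C assms(9)] show ?thesis
  proof eventually_elim
    case (elim \<omega>)
    have "\<bar>h x y\<bar> \<le> C" for x y using C[of "(x, y)"] by simp
    from u_statistic_tendsto[OF assms(7) this elim] show ?case
      unfolding eq .
  qed
qed

end
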